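(* Let $(X,d)$ be a Hadamard space and let $m$ be a positive integer. If $P_{C_i}$ is the metric projection of $X$ onto a nonempty closed and convex subset $C_i \subset X$ for all $i \in \{1,2,\dots,m\}$, with $\bigcap_{i=1}^m C_i \neq \emptyset$, then for any initial point $x_0 \in X$, the sequence defined for each $n \in \mathbb{N}$ by $$x_n := (P_{C_m} P_{C_{m-1}} \cdots P_{C_1})^n(x_0)$$ is $\Delta$-convergent to an element $x^\ast$ in $\bigcap_{i=1}^m C_i$.
   Context: A Hadamard space is a complete $\mathrm{CAT}(0)$ space. A subset $C \subset X$ is convex if for all $x,y \in C$ the geodesic segment $[x,y]$ joining $x$ and $y$ is contained in $C$. For a nonempty closed convex $C \subset X$, the metric projection $P_C : X \to C$ is $P_C(x) = \operatorname{arg\,min}_{y \in C} d(x,y)$, which is well defined and single-valued. Products of mappings denote composition (rightmost applied first), and the power $n$ denotes the $n$-th iterate. For a bounded sequence $\{x_n\}$ in $X$, the asymptotic center is $\mathcal{A}(\{x_n\}) = \{ z \in X : \limsup_{n} d(z,x_n) = \inf_{y \in X} \limsup_{n} d(y,x_n)\}$ (a singleton in a Hadamard space). A bounded sequence $\{x_n\}$ is $\Delta$-convergent to $z \in X$ if $\mathcal{A}(\{x_{n_i}\}) = \{z\}$ for each subsequence $\{x_{n_i}\}$ of $\{x_n\}$. *)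

theory Defs
  imports "HOL-Analysis.Analysis"
begin

definition (in metric_space) geodesic_segment :: "'a \<Rightarrow> 'a \<Rightarrow> 'a set \<Rightarrow> bool" where
  "geodesic_segment x y S \<longleftrightarrow>
     (\<exists>c :: real \<Rightarrow> 'a. c 0 = x \<and> c (dist x y) = y \<and>
        (\<forall>s\<in>{0..dist x y}. \<forall>t\<in>{0..dist x y}. dist (c s) (c t) = \<bar>s - t\<bar>) \<and>
        S = c ` {0..dist x y})"

text \<open>A triangle may have a point lying on two of its sides, with a different comparison point for
  each of them; comparison points are therefore a relation that depends on the chosen side
  \<open>S\<close> (a geodesic segment from \<open>p\<close> to \<open>q\<close>, with comparison segment from \<open>p'\<close> to \<open>q'\<close>).\<close>

definition (in metric_space) comparison_point ::
  "'a \<Rightarrow> 'a set \<Rightarrow> real^2 \<Rightarrow> real^2 \<Rightarrow> 'a \<Rightarrow> real^2 \<Rightarrow> bool" where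
  "comparison_point p S p' q' x x' \<longleftrightarrow>
     x \<in> S \<and> x' \<in> closed_segment p' q' \<and> dist p' x' = dist p x"

class cat0_space = metric_space +
  assumes geodesic_segment_exists: "\<exists>S. geodesic_segment x y S"
    and cat0_inequality:
      "\<lbrakk>geodesic_segment p q S\<^sub>1; geodesic_segment q r S\<^sub>2; geodesic_segment r p S\<^sub>3;
        dist p' q' = dist p q; dist q' r' = dist q r; dist r' p' = dist r p;
        comparison_point p S\<^sub>1 p' q' x x' \<or> comparison_point q S\<^sub>2 q' r' x x' \<or>
          comparison_point r S\<^sub>3 r' p' x x';
        comparison_point p S\<^sub>1 p' q' y y' \<or> comparison_point q S\<^sub>2 q' r' y y' \<or>
          comparison_point r S\<^sub>3 r' p' y y'\<rbrakk>
       \<Longrightarrow> dist x y \<le> dist x' y'"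

class hadamard_space = cat0_space + complete_space

definition geodesically_convex :: "'a::metric_space set \<Rightarrow> bool" where
  "geodesically_convex C \<longleftrightarrow> (\<forall>x\<in>C. \<forall>y\<in>C. \<forall>S. geodesic_segment x y S \<longrightarrow> S \<subseteq> C)"

definition metric_projection :: "'a::metric_space set \<Rightarrow> 'a \<Rightarrow> 'a" where
  "metric_projection C x = arg_min_on (\<lambda>y. dist x y) C"

text \<open>The limits superior are taken in the extended reals, where they always exist; for a bounded
  sequence they are the finite real ones.\<close>

definition asymptotic_center :: "(nat \<Rightarrow> 'a::metric_space) \<Rightarrow> 'a set" where
  "asymptotic_center X =
     {z. limsup (\<lambda>n. ereal (dist z (X n))) = (INF y. limsup (\<lambda>n. ereal (dist y (X n))))}"

definition delta_convergent_to :: "(nat \<Rightarrow> 'a::metric_space) \<Rightarrow> 'a \<Rightarrow> bool" where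
  "delta_convergent_to X z \<longleftrightarrow>
     bounded (range X) \<and> (\<forall>r. strict_mono r \<longrightarrow> asymptotic_center (X \<circ> r) = {z})"

end

theory Submission
  imports Defs
begin

text \<open>
  The curvature hypothesis enters through one inequality only: any two points \<open>x\<close>, \<open>y\<close> of a geodesic
  segment have between them, for each \<open>t \<in> [0, 1]\<close>, a point \<open>w\<close> with
  \<open>d(w,z)\<^sup>2 \<le> (1-t) d(x,z)\<^sup>2 + t d(y,z)\<^sup>2 - t(1-t) d(x,y)\<^sup>2\<close> for all \<open>z\<close>
  (\<open>geodesic_segment_CN_point\<close>). It says that squared distance functions are as convex as in a
  Hilbert space, and this survives taking a limit superior over a sequence. In a complete space such
  functionals have exactly one minimiser on each nonempty closed convex set
  (\<open>uniformly_convex_minimiser\<close>), which yields both the metric projection and the asymptotic center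
  of a bounded sequence.

  Letting \<open>t\<close> tend to \<open>0\<close> gives the obtuse angle property of projections
  (\<open>metric_projection_pythagoras\<close>): moving \<open>x\<close> to \<open>P x\<close> lowers the squared distance to every
  \<open>c \<in> C\<close> by at least \<open>d(x, P x)\<^sup>2\<close>. Along the cyclic iteration, the distance to a common point \<open>c\<close>
  of the sets is therefore nonincreasing at each of the \<open>m\<close> projections of a cycle. It converges,
  so the amounts lost within a cycle tend to \<open>0\<close>, and with them the lengths of the single
  projection steps. Thus \<open>x\<^sub>n\<close> is asymptotically indistinguishable from the intermediate point that
  lies in \<open>C\<^sub>i\<close>, for each \<open>i\<close>.

  Projecting onto \<open>C\<^sub>i\<close> does not increase distances to points of \<open>C\<^sub>i\<close>, so the projection of the
  asymptotic center of a sequence close to \<open>C\<^sub>i\<close> is again an asymptotic center, hence the same point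
  (\<open>asymptotic_center_in_convex\<close>). All subsequences of \<open>x\<^sub>n\<close> thus have their centers in the
  intersection of the \<open>C\<^sub>i\<close>, where the asymptotic radius is a genuine limit and so does not depend on
  the subsequence. This forces all centers to coincide
  (\<open>delta_convergent_to_of_converging_distances\<close>).
\<close>

section \<open>Comparison triangles and the CN inequality\<close>

lemma comparison_triangle_exists:
  fixes a b c :: real
  assumes "0 \<le> a" "0 \<le> b" "0 \<le> c" "a \<le> b + c" "b \<le> a + c" "c \<le> a + b"
  shows "\<exists>p q r :: real^2. dist p q = a \<and> dist q r = c \<and> dist r p = b"
proof -
  \<comment> \<open>The vertices are \<open>(0, 0)\<close>, \<open>(a, 0)\<close> and \<open>(u, v)\<close>, with \<open>u\<close> from the law of cosines. For \<open>a = 0\<close>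
      the division convention gives \<open>u = 0\<close>, which is then also a correct choice.\<close>
  define u where "u = (a\<^sup>2 + b\<^sup>2 - c\<^sup>2) / (2 * a)"
  define v where "v = sqrt (b\<^sup>2 - u\<^sup>2)"
  have cu: "a\<^sup>2 - 2 * a * u + b\<^sup>2 = c\<^sup>2"
  proof (cases "a = 0")
    case True
    then have "b = c" using assms by simp
    then show ?thesis using True by simp
  next
    case False
    then show ?thesis by (simp add: u_def)
  qed
  have "\<bar>u\<bar> \<le> b"
  proof (cases "a = 0")
    case True
    then show ?thesis using assms by (simp add: u_def)
  next
    case False
    then have "0 < a" using assms by simp
    have "(a - b)\<^sup>2 \<le> c\<^sup>2" and "c\<^sup>2 \<le> (a + b)\<^sup>2"
      using assms by (auto simp: abs_le_square_iff[symmetric])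
    then have "a * (2 * u) \<le> a * (2 * b)" "a * (- 2 * b) \<le> a * (2 * u)"
      using cu by (simp_all add: power2_eq_square algebra_simps)
    then show ?thesis using \<open>0 < a\<close> by (simp only: mult_le_cancel_left_pos)
  qed
  then have "u\<^sup>2 \<le> b\<^sup>2"
    using abs_le_square_iff[of u b] assms by simp
  then have v: "v\<^sup>2 = b\<^sup>2 - u\<^sup>2" by (simp add: v_def)
  let ?p = "vector [0, 0] :: real^2" and ?q = "vector [a, 0] :: real^2"
    and ?r = "vector [u, v] :: real^2"
  have d: "dist (vector [x, y] :: real^2) (vector [z, w]) = sqrt ((x - z)\<^sup>2 + (y - w)\<^sup>2)" for x y z w
    by (simp add: dist_vec_def L2_set_def sum_2 dist_real_def)
  have "dist ?p ?q = a" using assms by (simp add: d)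
  moreover have "dist ?r ?p = b" using assms v by (simp add: d)
  moreover have "dist ?q ?r = c"
  proof -
    have "(a - u)\<^sup>2 + (0 - v)\<^sup>2 = c\<^sup>2"
      using cu v by (simp add: power2_diff algebra_simps)
    then show ?thesis unfolding d using assms by simp
  qed
  ultimately show ?thesis by blast
qed

lemma stewart_identity:
  fixes p q r :: "'a::real_inner"
  shows "(dist (p + t *\<^sub>R (q - p)) r)\<^sup>2
    = (1 - t) * (dist p r)\<^sup>2 + t * (dist q r)\<^sup>2 - t * (1 - t) * (dist p q)\<^sup>2"
  unfolding dist_norm power2_norm_eq_inner
  by (simp add: inner_simps inner_commute algebra_simps power2_eq_square)

text \<open>
  The CN inequality of Bruhat and Tits, with a general weight. Take \<open>w\<close> at distance \<open>t d(x,y)\<close> from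
  \<open>x\<close>; comparing it with the opposite vertex of the triangle \<open>x\<close>, \<open>y\<close>, \<open>z\<close> reduces the claim to
  Stewart's identity in the plane. The same \<open>w\<close> serves for every \<open>z\<close>; this is essential where \<open>z\<close>
  runs through a sequence.
\<close>
lemma geodesic_segment_CN_point:
  fixes x y :: "'a::cat0_space"
  assumes S: "geodesic_segment x y S" and t: "0 \<le> t" "t \<le> 1"
  obtains w where "w \<in> S"
    "\<And>z. (dist w z)\<^sup>2 \<le> (1 - t) * (dist x z)\<^sup>2 + t * (dist y z)\<^sup>2 - t * (1 - t) * (dist x y)\<^sup>2"
proof -
  obtain g where g: "g 0 = x"
    "\<And>a b. a \<in> {0..dist x y} \<Longrightarrow> b \<in> {0..dist x y} \<Longrightarrow> dist (g a) (g b) = \<bar>a - b\<bar>"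
    "S = g ` {0..dist x y}"
    using S unfolding geodesic_segment_def by blast
  have tD: "t * dist x y \<in> {0..dist x y}"
    using t by (simp add: mult_left_le_one_le)
  define w where "w = g (t * dist x y)"
  have "w \<in> S" using tD g(3) by (simp add: w_def)
  have dw: "dist x w = t * dist x y"
    using g(2)[OF _ tD, of 0] g(1) t by (simp add: w_def)
  have "(dist w z)\<^sup>2 \<le> (1 - t) * (dist x z)\<^sup>2 + t * (dist y z)\<^sup>2 - t * (1 - t) * (dist x y)\<^sup>2" for z
  proof -
    obtain S2 S3 where S2: "geodesic_segment y z S2" and S3: "geodesic_segment z x S3"
      using geodesic_segment_exists by meson
    have "\<exists>p q r :: real^2. dist p q = dist x y \<and> dist q r = dist y z \<and> dist r p = dist z x"
      by (rule comparison_triangle_exists)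
        (use dist_triangle[of x y z] dist_triangle[of z x y] dist_triangle[of y z x]
          in \<open>simp_all add: dist_commute\<close>)
    then obtain p q r :: "real^2"
      where pqr: "dist p q = dist x y" "dist q r = dist y z" "dist r p = dist z x" by blast
    define w' where "w' = p + t *\<^sub>R (q - p)"
    have "w' = (1 - t) *\<^sub>R p + t *\<^sub>R q" by (simp add: w'_def algebra_simps)
    then have "w' \<in> closed_segment p q" using t by (auto simp: in_segment)
    moreover have "dist p w' = dist x w"
      using t pqr(1) by (simp add: w'_def dw dist_norm norm_minus_commute)
    ultimately have "comparison_point x S p q w w'"
      using \<open>w \<in> S\<close> by (simp add: comparison_point_def)
    \<comment> \<open>The vertex \<open>z\<close> is its own comparison point, as the start of the side from \<open>z\<close> to \<open>x\<close>.\<close>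
    moreover have "z \<in> S3" using S3 unfolding geodesic_segment_def by force
    then have "comparison_point z S3 r p z r" by (simp add: comparison_point_def)
    ultimately have "dist w z \<le> dist w' r"
      using cat0_inequality[OF S S2 S3 pqr] by blast
    then have "(dist w z)\<^sup>2 \<le> (dist w' r)\<^sup>2" by (simp add: power_mono)
    also have "\<dots> = (1 - t) * (dist x z)\<^sup>2 + t * (dist y z)\<^sup>2 - t * (1 - t) * (dist x y)\<^sup>2"
      unfolding w'_def stewart_identity using pqr by (simp add: dist_commute)
    finally show ?thesis .
  qed
  with \<open>w \<in> S\<close> show thesis by (rule that)
qed

lemma geodesically_convex_CN_point:
  fixes C :: "'a::cat0_space set"
  assumes "geodesically_convex C" "x \<in> C" "y \<in> C" "0 \<le> t" "t \<le> 1"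
  obtains w where "w \<in> C"
    "\<And>z. (dist w z)\<^sup>2 \<le> (1 - t) * (dist x z)\<^sup>2 + t * (dist y z)\<^sup>2 - t * (1 - t) * (dist x y)\<^sup>2"
proof -
  obtain S where S: "geodesic_segment x y S" using geodesic_segment_exists by blast
  then have "S \<subseteq> C" using assms unfolding geodesically_convex_def by blast
  with geodesic_segment_CN_point[OF S assms(4,5)] that show thesis by blast
qed

section \<open>Minimisers of uniformly convex functionals\<close>

text \<open>
  The midpoint inequality bounds the squared distance of two points by how far their values exceed
  the infimum. Hence minimising sequences are Cauchy, and two minimisers are at distance \<open>0\<close>.
\<close>
lemma uniformly_convex_minimiser:
  fixes f :: "'a::complete_space \<Rightarrow> real"
  assumes C: "C \<noteq> {}" "closed C"
    and cont: "continuous_on C f"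
    and bdd: "bdd_below (f ` C)"
    and conv: "\<And>x y. x \<in> C \<Longrightarrow> y \<in> C
      \<Longrightarrow> \<exists>w\<in>C. f w \<le> (f x + f y) / 2 - (dist x y)\<^sup>2 / 4"
  shows "\<exists>!z. z \<in> C \<and> (\<forall>y\<in>C. f z \<le> f y)"
proof -
  define I where "I = (INF y\<in>C. f y)"
  have lb: "I \<le> f y" if "y \<in> C" for y
    unfolding I_def using bdd that by (rule cINF_lower)
  have near: "(dist x y)\<^sup>2 \<le> 2 * ((f x - I) + (f y - I))" if xy: "x \<in> C" "y \<in> C" for x y
  proof -
    obtain w where "w \<in> C" "f w \<le> (f x + f y) / 2 - (dist x y)\<^sup>2 / 4"
      using conv[OF xy] by blast
    with lb[of w] show ?thesis by argo
  qed
  have "\<exists>y\<in>C. f y < I + 1 / real (Suc n)" for n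
    using cINF_less_iff[OF C(1) bdd, of "I + 1 / real (Suc n)"] by (simp add: I_def)
  then obtain s where s: "\<And>n. s n \<in> C" "\<And>n. f (s n) < I + 1 / real (Suc n)" by metis
  have "Cauchy s"
  proof (rule metric_CauchyI)
    fix e :: real assume "0 < e"
    then obtain N where N: "1 / real (Suc N) < e\<^sup>2 / 4"
      using nat_approx_posE[of "e\<^sup>2 / 4"] by auto
    have "dist (s k) (s n) < e" if "k \<ge> N" "n \<ge> N" for k n
    proof -
      have "f (s j) - I < e\<^sup>2 / 4" if "j \<ge> N" for j
      proof -
        have "1 / real (Suc j) \<le> 1 / real (Suc N)"
          using that by (simp add: frac_le)
        with s(2)[of j] N show ?thesis by linarith
      qed
      from this[OF that(1)] this[OF that(2)] have "(dist (s k) (s n))\<^sup>2 < e\<^sup>2"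
        using near[OF s(1) s(1), of k n] by argo
      with \<open>0 < e\<close> show ?thesis by (simp add: power_less_imp_less_base)
    qed
    then show "\<exists>N. \<forall>k\<ge>N. \<forall>n\<ge>N. dist (s k) (s n) < e" by blast
  qed
  then obtain z where z: "s \<longlonglongrightarrow> z" using Cauchy_convergent_iff convergent_def by blast
  then have zC: "z \<in> C" using C(2) s(1) closed_sequentially by blast
  have "(\<lambda>n. f (s n)) \<longlonglongrightarrow> f z"
    using continuous_on_tendsto_compose[OF cont z zC] s(1) by simp
  moreover have "(\<lambda>n. I + 1 / real (Suc n)) \<longlonglongrightarrow> I + 0"
    by (intro tendsto_add tendsto_const) (rule LIMSEQ_Suc[OF lim_1_over_n])
  ultimately have "f z \<le> I + 0"
    by (rule LIMSEQ_le) (use s(2) less_imp_le in blast)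
  then have fz: "f z = I" using lb[OF zC] by simp
  show ?thesis
  proof (rule ex1I[of _ z])
    show "z \<in> C \<and> (\<forall>y\<in>C. f z \<le> f y)" using zC fz lb by simp
  next
    fix u assume u: "u \<in> C \<and> (\<forall>y\<in>C. f u \<le> f y)"
    then have "f u = I" using zC fz lb[of u] by force
    with near[of u z] u zC fz have "(dist u z)\<^sup>2 \<le> 0" by simp
    then show "u = z" by simp
  qed
qed

section \<open>Metric projections\<close>

lemma metric_projection_minimises:
  fixes C :: "'a::hadamard_space set"
  assumes C: "C \<noteq> {}" "closed C" "geodesically_convex C"
  shows "metric_projection C x \<in> C" and "y \<in> C \<Longrightarrow> dist x (metric_projection C x) \<le> dist x y"
proof -
  have "\<exists>!z. z \<in> C \<and> (\<forall>y\<in>C. (dist x z)\<^sup>2 \<le> (dist x y)\<^sup>2)"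
  proof (rule uniformly_convex_minimiser[OF C(1,2)])
    show "continuous_on C (\<lambda>y. (dist x y)\<^sup>2)" by (intro continuous_intros)
    show "bdd_below ((\<lambda>y. (dist x y)\<^sup>2) ` C)" by (rule bdd_belowI[of _ 0]) auto
  next
    fix a b assume ab: "a \<in> C" "b \<in> C"
    obtain w where "w \<in> C" and w: "\<And>z. (dist w z)\<^sup>2 \<le>
        (1 - 1/2) * (dist a z)\<^sup>2 + 1/2 * (dist b z)\<^sup>2 - 1/2 * (1 - 1/2) * (dist a b)\<^sup>2"
      using geodesically_convex_CN_point[OF C(3) ab, of "1/2"] by auto
    then show "\<exists>w\<in>C. (dist x w)\<^sup>2 \<le> ((dist x a)\<^sup>2 + (dist x b)\<^sup>2) / 2 - (dist a b)\<^sup>2 / 4"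
      using w[of x] by (auto simp: dist_commute add_divide_distrib)
  qed
  then obtain z where z: "z \<in> C" "\<And>y. y \<in> C \<Longrightarrow> dist x z \<le> dist x y"
    by (auto simp: abs_le_square_iff[symmetric])
  have "is_arg_min (\<lambda>y. dist x y) (\<lambda>y. y \<in> C) z"
    using z by (auto simp: is_arg_min_linorder)
  then have "is_arg_min (\<lambda>y. dist x y) (\<lambda>y. y \<in> C) (metric_projection C x)"
    unfolding metric_projection_def arg_min_on_def arg_min_def by (rule someI)
  then show "metric_projection C x \<in> C" "y \<in> C \<Longrightarrow> dist x (metric_projection C x) \<le> dist x y"
    by (auto simp: is_arg_min_linorder)
qed

text \<open>
  A point a fraction \<open>t\<close> of the way from the projection to \<open>c\<close> is still in \<open>C\<close>, so it is not nearer to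
  \<open>x\<close>. The CN inequality turns this into the claim with the factor \<open>1 - t\<close> on one term, after
  division by \<open>t\<close>; then \<open>t\<close> tends to \<open>0\<close>.
\<close>
lemma metric_projection_pythagoras:
  fixes C :: "'a::hadamard_space set"
  assumes C: "C \<noteq> {}" "closed C" "geodesically_convex C" and c: "c \<in> C"
  shows "(dist x (metric_projection C x))\<^sup>2 + (dist (metric_projection C x) c)\<^sup>2 \<le> (dist x c)\<^sup>2"
proof -
  let ?p = "metric_projection C x"
  have p: "?p \<in> C" "\<And>y. y \<in> C \<Longrightarrow> dist x ?p \<le> dist x y"
    using metric_projection_minimises[OF C] by blast+
  have ineq: "(dist x ?p)\<^sup>2 + (1 - t) * (dist ?p c)\<^sup>2 \<le> (dist x c)\<^sup>2" if t: "0 < t" "t < 1" for t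
  proof -
    obtain w where "w \<in> C" and
      w: "(dist w x)\<^sup>2 \<le> (1 - t) * (dist ?p x)\<^sup>2 + t * (dist c x)\<^sup>2 - t * (1 - t) * (dist ?p c)\<^sup>2"
      using geodesically_convex_CN_point[OF C(3) p(1) c, of t] t by auto
    have "(dist x ?p)\<^sup>2 \<le> (dist w x)\<^sup>2"
      using p(2)[OF \<open>w \<in> C\<close>] by (simp add: dist_commute power_mono)
    with w have "(dist x ?p)\<^sup>2
        \<le> (1 - t) * (dist x ?p)\<^sup>2 + t * (dist x c)\<^sup>2 - t * (1 - t) * (dist ?p c)\<^sup>2"
      by (simp only: dist_commute[of ?p x] dist_commute[of c x])
    then have "t * ((dist x ?p)\<^sup>2 + (1 - t) * (dist ?p c)\<^sup>2) \<le> t * (dist x c)\<^sup>2"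
      by (simp add: algebra_simps)
    with t show ?thesis by simp
  qed
  have "((\<lambda>t. (dist x ?p)\<^sup>2 + (1 - t) * (dist ?p c)\<^sup>2)
      \<longlongrightarrow> (dist x ?p)\<^sup>2 + (1 - 0) * (dist ?p c)\<^sup>2) (at_right (0::real))"
    by (intro tendsto_intros)
  moreover have "\<forall>\<^sub>F t in at_right (0::real). (dist x ?p)\<^sup>2 + (1 - t) * (dist ?p c)\<^sup>2 \<le> (dist x c)\<^sup>2"
    unfolding eventually_at_right_field using ineq by (intro exI[of _ 1]) auto
  ultimately show ?thesis
    using tendsto_upperbound trivial_limit_at_right_real by fastforce
qed

section \<open>Asymptotic centers\<close>

text \<open>
  A real-valued version of the function minimised by the asymptotic center, so that its square can
  be handled as a convex functional. It carries information only for bounded sequences, where the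
  extended limit superior is finite.
\<close>
definition asymptotic_radius :: "(nat \<Rightarrow> 'a::metric_space) \<Rightarrow> 'a \<Rightarrow> real" where
  "asymptotic_radius X y = real_of_ereal (limsup (\<lambda>n. ereal (dist y (X n))))"

lemma ereal_asymptotic_radius:
  assumes "bounded (range X)"
  shows "ereal (asymptotic_radius X y) = limsup (\<lambda>n. ereal (dist y (X n)))"
proof -
  obtain B where B: "\<And>n. dist y (X n) \<le> B"
    using assms bounded_any_center[of "range X" y] by auto
  have "limsup (\<lambda>n. ereal (dist y (X n))) \<le> ereal B"
    using B by (intro Limsup_bounded) auto
  moreover have "0 \<le> limsup (\<lambda>n. ereal (dist y (X n)))"
    by (rule le_Limsup) auto
  ultimately show ?thesis
    unfolding asymptotic_radius_def
    by (cases "limsup (\<lambda>n. ereal (dist y (X n)))") auto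
qed

lemma asymptotic_radius_le:
  assumes "bounded (range X)" and "\<forall>\<^sub>F n in sequentially. dist y (X n) \<le> a"
  shows "asymptotic_radius X y \<le> a"
proof -
  have "ereal (asymptotic_radius X y) \<le> ereal a"
    unfolding ereal_asymptotic_radius[OF assms(1)] using assms(2) by (intro Limsup_bounded) simp
  then show ?thesis by simp
qed

lemma asymptotic_radius_less_eventually:
  assumes "bounded (range X)" and "asymptotic_radius X y < a"
  shows "\<forall>\<^sub>F n in sequentially. dist y (X n) < a"
proof -
  have "limsup (\<lambda>n. ereal (dist y (X n))) < ereal a"
    using assms by (simp add: ereal_asymptotic_radius[symmetric])
  from Limsup_lessD[OF this] show ?thesis by simp
qed

lemma asymptotic_radius_nonneg:
  assumes "bounded (range X)"
  shows "0 \<le> asymptotic_radius X y"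
proof -
  have "0 \<le> limsup (\<lambda>n. ereal (dist y (X n)))"
    by (rule le_Limsup) auto
  then show ?thesis by (simp add: asymptotic_radius_def real_of_ereal_pos)
qed

lemma asymptotic_radius_tendsto:
  assumes "(\<lambda>n. dist y (X n)) \<longlonglongrightarrow> l"
  shows "asymptotic_radius X y = l"
proof -
  have "limsup (\<lambda>n. ereal (dist y (X n))) = ereal l"
    by (intro lim_imp_Limsup) (use assms in auto)
  then show ?thesis by (simp add: asymptotic_radius_def)
qed

text \<open>
  With \<open>X = Y\<close> and \<open>d = 0\<close> this is the Lipschitz continuity of the radius; with \<open>y = y'\<close> and \<open>d = 0\<close>
  it says that asymptotically equal sequences have the same radius.
\<close>
lemma asymptotic_radius_perturb:
  assumes X: "bounded (range X)" and Y: "bounded (range Y)"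
    and lim: "(\<lambda>n. dist (X n) (Y n)) \<longlonglongrightarrow> d"
  shows "asymptotic_radius X y \<le> asymptotic_radius Y y' + dist y y' + d"
proof (rule field_le_epsilon)
  fix e :: real assume "0 < e"
  have "\<forall>\<^sub>F n in sequentially. dist y' (Y n) < asymptotic_radius Y y' + e / 2"
    using \<open>0 < e\<close> by (intro asymptotic_radius_less_eventually[OF Y]) simp
  moreover have "\<forall>\<^sub>F n in sequentially. dist (X n) (Y n) < d + e / 2"
    using \<open>0 < e\<close> by (intro order_tendstoD(2)[OF lim]) simp
  ultimately show "asymptotic_radius X y \<le> asymptotic_radius Y y' + dist y y' + d + e"
  proof (intro asymptotic_radius_le[OF X], eventually_elim)
    case (elim n)
    with dist_triangle[of y "X n" y'] dist_triangle[of y' "X n" "Y n"] show ?case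
      by (simp add: dist_commute)
  qed
qed

lemma asymptotic_center_eq:
  assumes "bounded (range X)"
  shows "asymptotic_center X = {z. \<forall>y. asymptotic_radius X z \<le> asymptotic_radius X y}"
proof -
  have "ereal r = (INF y. ereal (asymptotic_radius X y)) \<longleftrightarrow> (\<forall>y. r \<le> asymptotic_radius X y)"
    if r: "r = asymptotic_radius X z" for r z
  proof
    assume eq: "ereal r = (INF y. ereal (asymptotic_radius X y))"
    have "ereal r \<le> ereal (asymptotic_radius X y)" for y
      unfolding eq by (rule INF_lower) simp
    then show "\<forall>y. r \<le> asymptotic_radius X y" by simp
  next
    assume "\<forall>y. r \<le> asymptotic_radius X y"
    then show "ereal r = (INF y. ereal (asymptotic_radius X y))"
      unfolding r by (intro antisym INF_greatest INF_lower2[of z]) auto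
  qed
  then show ?thesis
    unfolding asymptotic_center_def ereal_asymptotic_radius[OF assms, symmetric] by blast
qed

text \<open>
  The squared radius inherits the midpoint inequality from the squared distances to the points of
  the sequence, because the midpoint given by the CN inequality does not depend on those points.
\<close>
lemma asymptotic_center_singleton:
  fixes X :: "nat \<Rightarrow> 'a::hadamard_space"
  assumes X: "bounded (range X)"
  obtains z where "asymptotic_center X = {z}"
proof -
  let ?r = "asymptotic_radius X"
  have "\<exists>!z. z \<in> UNIV \<and> (\<forall>y\<in>UNIV. (?r z)\<^sup>2 \<le> (?r y)\<^sup>2)"
  proof (rule uniformly_convex_minimiser)
    have "dist (?r x) (?r y) \<le> dist x y" for x y
      using asymptotic_radius_perturb[OF X X, of 0 x y] asymptotic_radius_perturb[OF X X, of 0 y x]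
      by (simp add: dist_real_def dist_commute abs_le_iff)
    then have "1-lipschitz_on UNIV ?r" by (intro lipschitz_onI) auto
    then show "continuous_on UNIV (\<lambda>y. (?r y)\<^sup>2)"
      by (intro continuous_on_power lipschitz_on_continuous_on)
    show "bdd_below (range (\<lambda>y. (?r y)\<^sup>2))" by (rule bdd_belowI[of _ 0]) auto
  next
    fix a b :: 'a
    obtain w where w: "\<And>z. (dist w z)\<^sup>2 \<le>
        (1 - 1/2) * (dist a z)\<^sup>2 + 1/2 * (dist b z)\<^sup>2 - 1/2 * (1 - 1/2) * (dist a b)\<^sup>2"
      using geodesically_convex_CN_point[of UNIV a b "1/2"] by (auto simp: geodesically_convex_def)
    \<comment> \<open>Both radii are exceeded by \<open>e\<close>, since only bounds larger than the limit superior are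
        guaranteed to hold from some index on; \<open>e\<close> then tends to \<open>0\<close>.\<close>
    have bound: "(?r w)\<^sup>2 \<le> ((?r a + e)\<^sup>2 + (?r b + e)\<^sup>2) / 2 - (dist a b)\<^sup>2 / 4" if "0 < e" for e
    proof -
      let ?B = "((?r a + e)\<^sup>2 + (?r b + e)\<^sup>2) / 2 - (dist a b)\<^sup>2 / 4"
      have "\<forall>\<^sub>F n in sequentially. dist a (X n) < ?r a + e"
        using that by (intro asymptotic_radius_less_eventually[OF X]) simp
      moreover have "\<forall>\<^sub>F n in sequentially. dist b (X n) < ?r b + e"
        using that by (intro asymptotic_radius_less_eventually[OF X]) simp
      ultimately have "\<forall>\<^sub>F n in sequentially. (dist w (X n))\<^sup>2 \<le> ?B"
      proof eventually_elim
        case (elim n)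
        then have "(dist a (X n))\<^sup>2 \<le> (?r a + e)\<^sup>2" "(dist b (X n))\<^sup>2 \<le> (?r b + e)\<^sup>2"
          by (simp_all add: power_mono)
        with w[of "X n"] show ?case by argo
      qed
      then have le: "\<forall>\<^sub>F n in sequentially. dist w (X n) \<le> sqrt ?B"
        by (rule eventually_mono) (rule real_le_rsqrt)
      have "(?r w)\<^sup>2 \<le> (sqrt ?B)\<^sup>2"
        using asymptotic_radius_le[OF X le] asymptotic_radius_nonneg[OF X, of w]
        by (rule power_mono)
      moreover have "0 \<le> ?B"
        using \<open>\<forall>\<^sub>F n in sequentially. (dist w (X n))\<^sup>2 \<le> ?B\<close>
        by (meson eventually_happens order_trans sequentially_bot zero_le_power2)
      ultimately show ?thesis by simp
    qed
    have "((\<lambda>e. ((?r a + e)\<^sup>2 + (?r b + e)\<^sup>2) / 2 - (dist a b)\<^sup>2 / 4)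
        \<longlongrightarrow> ((?r a + 0)\<^sup>2 + (?r b + 0)\<^sup>2) / 2 - (dist a b)\<^sup>2 / 4) (at_right (0::real))"
      by (intro tendsto_intros) auto
    moreover have "\<forall>\<^sub>F e in at_right (0::real).
        (?r w)\<^sup>2 \<le> ((?r a + e)\<^sup>2 + (?r b + e)\<^sup>2) / 2 - (dist a b)\<^sup>2 / 4"
      unfolding eventually_at_right_field using bound by (intro exI[of _ 1]) auto
    ultimately have "(?r w)\<^sup>2 \<le> ((?r a + 0)\<^sup>2 + (?r b + 0)\<^sup>2) / 2 - (dist a b)\<^sup>2 / 4"
      by (rule tendsto_lowerbound) simp
    then show "\<exists>w\<in>UNIV. (?r w)\<^sup>2 \<le> ((?r a)\<^sup>2 + (?r b)\<^sup>2) / 2 - (dist a b)\<^sup>2 / 4" by auto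
  qed auto
  then have "\<exists>!z. \<forall>y. ?r z \<le> ?r y"
    by (simp add: abs_le_square_iff[symmetric] asymptotic_radius_nonneg[OF X])
  then obtain z where "{z. \<forall>y. ?r z \<le> ?r y} = {z}" by blast
  then show thesis using that asymptotic_center_eq[OF X] by simp
qed

text \<open>
  Projecting the center \<open>z\<close> onto \<open>C\<close> brings it no farther from any point of \<open>Y\<close>, so the projection
  has no larger radius and is a center too. Uniqueness makes \<open>z\<close> a fixed point of the projection.
\<close>
lemma asymptotic_center_in_convex:
  fixes X :: "nat \<Rightarrow> 'a::hadamard_space"
  assumes C: "C \<noteq> {}" "closed C" "geodesically_convex C"
    and Y: "\<And>n. Y n \<in> C" and X: "bounded (range X)"
    and lim: "(\<lambda>n. dist (X n) (Y n)) \<longlonglongrightarrow> 0"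
  shows "asymptotic_center X \<subseteq> C"
proof -
  have bY: "bounded (range Y)"
  proof -
    obtain z B where B: "\<And>n. dist z (X n) \<le> B"
      using X by (auto simp: bounded_def)
    obtain K where K: "\<And>n. dist (X n) (Y n) \<le> K"
      using convergent_imp_bounded[OF lim] by (auto simp: bounded_iff)
    have "dist z (Y n) \<le> B + K" for n
      using dist_triangle[of z "Y n" "X n"] B[of n] K[of n] by linarith
    then show ?thesis by (auto simp: bounded_def)
  qed
  have lim': "(\<lambda>n. dist (Y n) (X n)) \<longlonglongrightarrow> 0"
    using lim by (simp add: dist_commute)
  have rXY: "asymptotic_radius X y = asymptotic_radius Y y" for y
    using asymptotic_radius_perturb[OF X bY lim, of y y]
      asymptotic_radius_perturb[OF bY X lim', of y y] by simp
  obtain z where z: "asymptotic_center X = {z}" using asymptotic_center_singleton[OF X] .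
  let ?p = "metric_projection C z"
  have closer: "dist ?p c \<le> dist z c" if "c \<in> C" for c
  proof (rule power2_le_imp_le)
    show "(dist ?p c)\<^sup>2 \<le> (dist z c)\<^sup>2"
      using metric_projection_pythagoras[OF C that, of z] zero_le_power2[of "dist z ?p"] by linarith
  qed simp
  have "asymptotic_radius Y ?p \<le> asymptotic_radius Y z"
  proof (rule field_le_epsilon)
    fix e :: real assume "0 < e"
    then have "\<forall>\<^sub>F n in sequentially. dist z (Y n) < asymptotic_radius Y z + e"
      by (intro asymptotic_radius_less_eventually[OF bY]) simp
    then show "asymptotic_radius Y ?p \<le> asymptotic_radius Y z + e"
      by (intro asymptotic_radius_le[OF bY])
        (auto elim!: eventually_mono intro: order_trans[OF closer[OF Y]])
  qed
  moreover have "z \<in> asymptotic_center X" by (simp add: z)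
  ultimately have "?p \<in> asymptotic_center X"
    unfolding asymptotic_center_eq[OF X] rXY by (auto intro: order_trans)
  then have "?p = z" using z by simp
  then show ?thesis using metric_projection_minimises(1)[OF C, of z] z by simp
qed

section \<open>Convergence when distances converge\<close>

text \<open>
  A metric form of Opial's argument. On \<open>F\<close> the radius of a subsequence agrees with that of the
  whole sequence, both being the limit of the distances. The center \<open>v\<close> of the whole sequence
  therefore has, for the subsequence, a radius no larger than that of the subsequence's own center,
  and the two centers are equal by uniqueness.
\<close>
lemma delta_convergent_to_of_converging_distances:
  fixes X :: "nat \<Rightarrow> 'a::hadamard_space"
  assumes X: "bounded (range X)"
    and conv: "\<And>c. c \<in> F \<Longrightarrow> convergent (\<lambda>n. dist c (X n))"
    and centers: "\<And>r. strict_mono r \<Longrightarrow> asymptotic_center (X \<circ> r) \<subseteq> F"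
  shows "\<exists>z\<in>F. delta_convergent_to X z"
proof -
  have center_of: "\<exists>z\<in>F. asymptotic_center (X \<circ> r) = {z}" and bX: "bounded (range (X \<circ> r))"
    if "strict_mono r" for r
  proof -
    show b: "bounded (range (X \<circ> r))" by (rule bounded_subset[OF X]) auto
    show "\<exists>z\<in>F. asymptotic_center (X \<circ> r) = {z}"
      using asymptotic_center_singleton[OF b] centers[OF that] by (metis insert_subset)
  qed
  have radius_subseq: "asymptotic_radius (X \<circ> r) c = asymptotic_radius X c"
    if r: "strict_mono r" and c: "c \<in> F" for r c
  proof -
    obtain l where l: "(\<lambda>n. dist c (X n)) \<longlonglongrightarrow> l"
      using conv[OF c] by (auto simp: convergent_def)
    have "(\<lambda>n. dist c ((X \<circ> r) n)) \<longlonglongrightarrow> l"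
      using LIMSEQ_subseq_LIMSEQ[OF l r] by (simp add: o_def)
    with l show ?thesis by (simp add: asymptotic_radius_tendsto)
  qed
  obtain v where v: "v \<in> F" "asymptotic_center X = {v}"
    using center_of[of id] by (auto simp: strict_mono_id)
  have "asymptotic_center (X \<circ> r) = {v}" if r: "strict_mono r" for r
  proof -
    obtain u where u: "u \<in> F" "asymptotic_center (X \<circ> r) = {u}"
      using center_of[OF r] by blast
    have "asymptotic_radius X v \<le> asymptotic_radius X u"
      using v(2) unfolding asymptotic_center_eq[OF X] by blast
    then have "asymptotic_radius (X \<circ> r) v \<le> asymptotic_radius (X \<circ> r) u"
      by (simp add: radius_subseq[OF r] u v)
    moreover have "u \<in> asymptotic_center (X \<circ> r)" by (simp add: u)
    ultimately have "v \<in> asymptotic_center (X \<circ> r)"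
      unfolding asymptotic_center_eq[OF bX[OF r]] by (auto intro: order_trans)
    then show ?thesis using u by simp
  qed
  with v X show ?thesis by (auto simp: delta_convergent_to_def)
qed

section \<open>Cyclic projections\<close>

theorem corollary4:
  fixes C :: "nat \<Rightarrow> 'a::hadamard_space set" and m :: nat and x\<^sub>0 :: 'a
  assumes "m \<ge> 1"
    and "\<And>i. i \<in> {1..m} \<Longrightarrow> C i \<noteq> {}"
    and "\<And>i. i \<in> {1..m} \<Longrightarrow> closed (C i)"
    and "\<And>i. i \<in> {1..m} \<Longrightarrow> geodesically_convex (C i)"
    and "(\<Inter>i\<in>{1..m}. C i) \<noteq> {}"
  shows "\<exists>x\<in>(\<Inter>i\<in>{1..m}. C i).
    delta_convergent_to (\<lambda>n. (fold (\<lambda>i. metric_projection (C i)) [1..<Suc m] ^^ n) x\<^sub>0) x"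
proof -
  let ?F = "\<Inter>i\<in>{1..m}. C i"
  \<comment> \<open>\<open>T k\<close> performs the first \<open>k\<close> projections of a cycle.\<close>
  define T where "T k = fold (\<lambda>i. metric_projection (C i)) [1..<Suc k]" for k
  define X where "X n = (T m ^^ n) x\<^sub>0" for n
  have T_0: "T 0 x = x" and T_Suc: "T (Suc k) x = metric_projection (C (Suc k)) (T k x)" for k x
    by (simp_all add: T_def)
  have X_Suc: "X (Suc n) = T m (X n)" for n by (simp add: X_def)
  have pyth: "(dist (T k x) (T (Suc k) x))\<^sup>2 + (dist c (T (Suc k) x))\<^sup>2 \<le> (dist c (T k x))\<^sup>2"
    if "c \<in> ?F" "k < m" for c k x
    using metric_projection_pythagoras[of "C (Suc k)" c "T k x"] that assms(2-4)[of "Suc k"]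
    by (simp add: T_Suc dist_commute)
  have T_dec: "dist c (T (Suc k) x) \<le> dist c (T k x)" if "c \<in> ?F" "k < m" for c k x
  proof (rule power2_le_imp_le)
    show "(dist c (T (Suc k) x))\<^sup>2 \<le> (dist c (T k x))\<^sup>2"
      using pyth[OF that, of x] zero_le_power2[of "dist (T k x) (T (Suc k) x)"] by linarith
  qed simp
  have T_mono: "dist c (T l x) \<le> dist c (T k x)" if "c \<in> ?F" "k \<le> l" "l \<le> m" for c k l x
    using that(2,3)
  proof (induction l rule: dec_induct)
    case (step l)
    then show ?case using T_dec[OF that(1), of l x] by simp
  qed simp
  have X_dec: "dist c (X (Suc n)) \<le> dist c (X n)" if "c \<in> ?F" for c n
    using T_mono[OF that, of 0 m "X n"] by (simp add: X_Suc T_0)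
  have conv: "convergent (\<lambda>n. dist c (X n))" if "c \<in> ?F" for c
  proof -
    have "decseq (\<lambda>n. dist c (X n))" using X_dec[OF that] by (rule decseq_SucI)
    then show ?thesis
      using decseq_convergent[of "\<lambda>n. dist c (X n)" 0] by (auto simp: convergent_def)
  qed
  obtain c where c: "c \<in> ?F" using assms(5) by blast
  obtain l where l: "(\<lambda>n. dist c (X n)) \<longlonglongrightarrow> l"
    using conv[OF c] by (auto simp: convergent_def)
  have bX: "bounded (range X)"
  proof -
    obtain K where "\<And>n. dist c (X n) \<le> K"
      using convergent_imp_bounded[OF l] by (auto simp: bounded_iff)
    then show ?thesis by (auto simp: bounded_def)
  qed
  \<comment> \<open>Within a cycle the distance to \<open>c\<close> stays between its values at the two ends of the cycle.\<close>
  have T_lim: "(\<lambda>n. dist c (T k (X n))) \<longlonglongrightarrow> l" if "k \<le> m" for k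
  proof (rule tendsto_sandwich[OF _ _ LIMSEQ_Suc[OF l] l])
    show "\<forall>\<^sub>F n in sequentially. dist c (X (Suc n)) \<le> dist c (T k (X n))"
      using T_mono[OF c that order_refl] by (simp add: X_Suc)
    show "\<forall>\<^sub>F n in sequentially. dist c (T k (X n)) \<le> dist c (X n)"
      using T_mono[OF c _ that, of 0] by (simp add: T_0)
  qed
  \<comment> \<open>The squared length of a projection step is at most the loss in squared distance to \<open>c\<close>.\<close>
  have step: "(\<lambda>n. dist (T k (X n)) (T (Suc k) (X n))) \<longlonglongrightarrow> 0" if "k < m" for k
  proof -
    have "(\<lambda>n. (dist c (T k (X n)))\<^sup>2 - (dist c (T (Suc k) (X n)))\<^sup>2) \<longlonglongrightarrow> l\<^sup>2 - l\<^sup>2"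
      using that by (intro tendsto_intros T_lim) auto
    then have lim0: "(\<lambda>n. (dist c (T k (X n)))\<^sup>2 - (dist c (T (Suc k) (X n)))\<^sup>2) \<longlonglongrightarrow> 0" by simp
    have "(\<lambda>n. (dist (T k (X n)) (T (Suc k) (X n)))\<^sup>2) \<longlonglongrightarrow> 0"
    proof (rule tendsto_sandwich[OF _ _ tendsto_const lim0])
      show "\<forall>\<^sub>F n in sequentially. (dist (T k (X n)) (T (Suc k) (X n)))\<^sup>2
          \<le> (dist c (T k (X n)))\<^sup>2 - (dist c (T (Suc k) (X n)))\<^sup>2"
        using pyth[OF c that] by (simp add: le_diff_eq)
    qed simp
    from tendsto_real_sqrt[OF this] show ?thesis by simp
  qed
  have T_close: "(\<lambda>n. dist (X n) (T k (X n))) \<longlonglongrightarrow> 0" if "k \<le> m" for k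
    using that
  proof (induction k)
    case 0
    show ?case by (simp add: T_0)
  next
    case (Suc k)
    then have "(\<lambda>n. dist (X n) (T k (X n)) + dist (T k (X n)) (T (Suc k) (X n))) \<longlonglongrightarrow> 0 + 0"
      by (intro tendsto_add step) auto
    then have lim0: "(\<lambda>n. dist (X n) (T k (X n)) + dist (T k (X n)) (T (Suc k) (X n))) \<longlonglongrightarrow> 0" by simp
    show ?case
      by (rule tendsto_sandwich[OF _ _ tendsto_const lim0]) (auto simp: dist_triangle)
  qed
  have "asymptotic_center (X \<circ> r) \<subseteq> ?F" if r: "strict_mono r" for r
  proof (rule INT_greatest)
    fix i assume i: "i \<in> {1..m}"
    then obtain k where k: "i = Suc k" by (cases i) auto
    show "asymptotic_center (X \<circ> r) \<subseteq> C i"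
    proof (rule asymptotic_center_in_convex[where Y = "\<lambda>n. T i (X (r n))"])
      show "T i (X (r n)) \<in> C i" for n
        using metric_projection_minimises(1)[OF assms(2-4)[OF i]] by (simp add: k T_Suc)
      show "bounded (range (X \<circ> r))" by (rule bounded_subset[OF bX]) auto
      show "(\<lambda>n. dist ((X \<circ> r) n) (T i (X (r n)))) \<longlonglongrightarrow> 0"
        using LIMSEQ_subseq_LIMSEQ[OF T_close r, of i] i by (simp add: o_def)
    qed (use assms(2-4)[OF i] in auto)
  qed
  then have "\<exists>z\<in>?F. delta_convergent_to X z"
    by (intro delta_convergent_to_of_converging_distances[OF bX conv])
  then show ?thesis unfolding X_def T_def .
qed

end
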